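(* Let $A\in\mathbb{R}^{m\times n}$ have a nontrivial nullspace, and define $$S(A)=\max_{x\neq 0,\;Ax=0}\frac{\|x\|_2}{\|x\|_1}.$$ Let $$SDP(A)=\max\left\{\operatorname{Tr}X:\ X\in\mathbf{S}_n,\ \operatorname{Tr}(A^TAX)=0,\ \|X\|_1\leq 1,\ X\succeq 0\right\},$$ which is the optimal value of a semidefinite program in the variable $X$. Then $$S(A)^2\leq SDP(A).$$
   Context: $\mathbf{S}_n$ is the set of real symmetric $n\times n$ matrices, $X\succeq 0$ means that $X$ is positive semidefinite, and for a matrix $X$, $\|X\|_1=\sum_{i,j}|X_{ij}|$ is the entrywise $\ell_1$ norm. For vectors, $\|\cdot\|_1$ and $\|\cdot\|_2$ are the usual $\ell_1$ and Euclidean norms. *)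

theory Defs
  imports "HOL-Analysis.Analysis"
begin

definition vec_l1_norm :: "real ^ 'n \<Rightarrow> real" where
  "vec_l1_norm x = (\<Sum>i\<in>UNIV. \<bar>x $ i\<bar>)"

definition mat_l1_norm :: "real ^ 'n ^ 'm \<Rightarrow> real" where
  "mat_l1_norm X = (\<Sum>i\<in>UNIV. \<Sum>j\<in>UNIV. \<bar>X $ i $ j\<bar>)"

definition symmetric_matrices :: "(real ^ 'n ^ 'n) set" where
  "symmetric_matrices = {X. transpose X = X}"

(* Symmetry is not part of this predicate; it is required separately through
   membership in symmetric_matrices. *)
definition pos_semidef :: "real ^ 'n ^ 'n \<Rightarrow> bool" where
  "pos_semidef X \<longleftrightarrow> (\<forall>v. 0 \<le> v \<bullet> (X *v v))"

(* Both maxima below are attained maxima rather than suprema: GREATEST denotes the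
   largest element of the set of values, and is unspecified if there is none.
   On real ^ 'n, norm is the Euclidean norm. *)
definition S :: "real ^ 'n ^ 'm \<Rightarrow> real" where
  "S A = (GREATEST r. r \<in> {norm x / vec_l1_norm x | x. x \<noteq> 0 \<and> A *v x = 0})"

definition SDP_feasible :: "real ^ 'n ^ 'm \<Rightarrow> (real ^ 'n ^ 'n) set" where
  "SDP_feasible A = {X. X \<in> symmetric_matrices \<and>
     trace (transpose A ** A ** X) = 0 \<and> mat_l1_norm X \<le> 1 \<and> pos_semidef X}"

definition SDP :: "real ^ 'n ^ 'm \<Rightarrow> real" where
  "SDP A = (GREATEST t. t \<in> {trace X | X. X \<in> SDP_feasible A})"

end

theory Submission
  imports Defs
begin

text \<open>If \<open>x\<close> attains the maximum defining \<open>S A\<close>, scaled to have unit \<open>\<ell>\<^sub>1\<close> norm, then the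
  rank-one matrix with entries \<open>x\<^sub>i x\<^sub>j\<close> is feasible for the semidefinite program and has trace
  \<open>(S A)\<^sup>2\<close>. Both maxima exist by compactness, so \<open>GREATEST\<close> is not a junk value.\<close>

lemma Greatest_mem_eqI:
  fixes M :: "'a::order set"
  assumes "t \<in> M" "\<And>s. s \<in> M \<Longrightarrow> s \<le> t"
  shows "(GREATEST r. r \<in> M) = t"
  using assms by (intro Greatest_equality)

lemma vec_l1_norm_scaleR: "vec_l1_norm (c *\<^sub>R x) = \<bar>c\<bar> * vec_l1_norm x"
  by (simp add: vec_l1_norm_def abs_mult sum_distrib_left)

lemma norm_le_vec_l1_norm: "norm x \<le> vec_l1_norm x"
  unfolding vec_l1_norm_def by (rule norm_le_l1_cart)

lemma vec_l1_norm_pos: "x \<noteq> 0 \<Longrightarrow> 0 < vec_l1_norm x"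
  using norm_le_vec_l1_norm[of x] by (smt (verit) zero_less_norm_iff)

text \<open>Here \<open>norm\<close> is the Frobenius norm: an l2 sum is bounded by an l1 sum, first
  over the rows and then within each row. This is what bounds the feasible set.\<close>

lemma norm_le_mat_l1_norm: "norm X \<le> mat_l1_norm X"
proof -
  have "norm X \<le> (\<Sum>i\<in>UNIV. norm (X $ i))"
    unfolding norm_vec_def by (rule L2_set_le_sum) simp
  also have "\<dots> \<le> mat_l1_norm X"
    unfolding mat_l1_norm_def by (intro sum_mono norm_le_l1_cart)
  finally show ?thesis .
qed

text \<open>The quotient does not change when \<open>x\<close> is rescaled, so it may be maximised
  over the l1 unit sphere of the nullspace, where it is just \<open>norm\<close>. That slice
  \<open>K\<close> is compact and avoids 0.\<close>

lemma S_attained: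
  fixes A :: "real ^ 'n ^ 'm"
  assumes "{x. A *v x = 0} \<noteq> {0}"
  obtains y where "A *v y = 0" "vec_l1_norm y = 1" "S A = norm y"
proof -
  define K where "K = {x. A *v x = 0 \<and> vec_l1_norm x = 1}"
  define Q where "Q = {norm x / vec_l1_norm x | x. x \<noteq> 0 \<and> A *v x = 0}"
  have scale: "x /\<^sub>R vec_l1_norm x \<in> K \<and> norm (x /\<^sub>R vec_l1_norm x) = norm x / vec_l1_norm x"
    if "x \<noteq> 0" "A *v x = 0" for x
    using that vec_l1_norm_pos[of x]
    by (simp add: K_def vec_l1_norm_scaleR matrix_vector_mult_scaleR field_simps)
  have "closed K"
    unfolding K_def vec_l1_norm_def
    by (intro closed_Collect_conj closed_Collect_eq continuous_intros
        linear_continuous_on matrix_vector_mul_bounded_linear)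
  moreover have "bounded K"
    unfolding bounded_iff K_def using norm_le_vec_l1_norm by (metis (mono_tags) mem_Collect_eq)
  ultimately have "compact K"
    by (simp add: compact_eq_bounded_closed)
  \<comment> \<open>Since 0 always lies in the nullspace, differing from \<open>{0}\<close> forces a
    nonzero element.\<close>
  moreover obtain x where "x \<noteq> 0" "A *v x = 0"
    using assms by (auto simp: set_eq_iff)
  then have "K \<noteq> {}"
    using scale by blast
  ultimately obtain y where y: "y \<in> K" "\<And>z. z \<in> K \<Longrightarrow> norm z \<le> norm y"
    using continuous_attains_sup[of K norm] by (auto intro: continuous_intros)
  have "S A = norm y"
    unfolding S_def Q_def[symmetric]
  proof (rule Greatest_mem_eqI)
    have "y \<noteq> 0"
      using y(1) by (auto simp: K_def vec_l1_norm_def)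
    then show "norm y \<in> Q"
      using y(1) by (force simp: K_def Q_def)
    show "s \<le> norm y" if "s \<in> Q" for s
      using that scale y(2) by (force simp: Q_def)
  qed
  with y(1) show thesis
    by (intro that) (auto simp: K_def)
qed

lemma compact_SDP_feasible: "compact (SDP_feasible A)"
proof -
  have "closed (SDP_feasible A)"
    \<comment> \<open>In terms of entries every constraint is an equation or weak inequality between
      continuous functions; semidefiniteness is an intersection of such conditions over all
      \<open>v\<close>.\<close>
    unfolding SDP_feasible_def symmetric_matrices_def mat_l1_norm_def pos_semidef_def mem_Collect_eq
      trace_def transpose_def matrix_matrix_mult_def matrix_vector_mult_def inner_vec_def
    by (intro closed_Collect_conj closed_Collect_all closed_Collect_eq closed_Collect_le
        continuous_intros)
  moreover have "bounded (SDP_feasible A)"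
    unfolding bounded_iff SDP_feasible_def
    using norm_le_mat_l1_norm by (metis (mono_tags, lifting) mem_Collect_eq order_trans)
  ultimately show ?thesis
    by (simp add: compact_eq_bounded_closed)
qed

text \<open>\<open>SDP A\<close> is known to be an upper bound only once the maximum is attained;
  \<open>X\<close> itself supplies the nonemptiness that the compactness argument needs.\<close>

lemma trace_le_SDP:
  assumes "X \<in> SDP_feasible A"
  shows "trace X \<le> SDP A"
proof -
  have "continuous_on (SDP_feasible A) trace"
    unfolding trace_def by (intro continuous_intros)
  then obtain Y where Y: "Y \<in> SDP_feasible A" "\<And>Z. Z \<in> SDP_feasible A \<Longrightarrow> trace Z \<le> trace Y"
    using continuous_attains_sup[OF compact_SDP_feasible] assms by blast
  have "SDP A = trace Y"
    unfolding SDP_def using Y by (intro Greatest_mem_eqI) auto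
  with Y(2) assms show ?thesis
    by simp
qed

definition outer_square :: "real ^ 'n \<Rightarrow> real ^ 'n ^ 'n" where
  "outer_square x = (\<chi> i j. x $ i * x $ j)"

lemma trace_outer_square: "trace (outer_square x) = (norm x)\<^sup>2"
  by (simp add: trace_def outer_square_def power2_norm_eq_inner inner_vec_def)

lemma mat_l1_norm_outer_square: "mat_l1_norm (outer_square x) = (vec_l1_norm x)\<^sup>2"
  by (simp add: mat_l1_norm_def outer_square_def vec_l1_norm_def power2_eq_square sum_product abs_mult)

text \<open>The matrix maps everything into the line through \<open>x\<close>. Hence its quadratic
  form at \<open>v\<close> is the square of \<open>x \<bullet> v\<close>, and any \<open>A\<close>
  that kills \<open>x\<close> kills the whole product.\<close>

lemma outer_square_mult_vector: "outer_square x *v v = (x \<bullet> v) *\<^sub>R x"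
  by (simp add: outer_square_def matrix_vector_mult_def inner_vec_def vec_eq_iff sum_distrib_left
      sum_distrib_right mult_ac)

lemma pos_semidef_outer_square: "pos_semidef (outer_square x)"
  by (simp add: pos_semidef_def outer_square_mult_vector inner_commute)

lemma matrix_mult_outer_square_eq_0:
  assumes "A *v x = 0"
  shows "A ** outer_square x = 0"
proof -
  have "(A ** outer_square x) *v v = 0" for v
    by (simp add: matrix_vector_mul_assoc[symmetric] outer_square_mult_vector
        matrix_vector_mult_scaleR assms)
  then show ?thesis
    by (simp add: matrix_eq)
qed

lemma outer_square_feasible:
  assumes "A *v x = 0" "vec_l1_norm x \<le> 1"
  shows "outer_square x \<in> SDP_feasible A"
proof -
  have "(vec_l1_norm x)\<^sup>2 \<le> 1"
    using assms(2) by (simp add: power_le_one vec_l1_norm_def sum_nonneg)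
  moreover have "transpose (outer_square x) = outer_square x"
    by (simp add: transpose_def outer_square_def mult.commute)
  moreover have "trace (transpose A ** A ** outer_square x) = 0"
    \<comment> \<open>Reassociating exposes the factor \<open>A ** outer_square x\<close>, which
      vanishes.\<close>
    unfolding matrix_mul_assoc[symmetric] matrix_mult_outer_square_eq_0[OF assms(1)]
    by (simp add: trace_def matrix_matrix_mult_def)
  ultimately show ?thesis
    by (simp add: SDP_feasible_def symmetric_matrices_def mat_l1_norm_outer_square
        pos_semidef_outer_square)
qed

theorem lemma4p1:
  fixes A :: "real ^ 'n ^ 'm"
  assumes "{x. A *v x = 0} \<noteq> {0}"
  shows "(S A)\<^sup>2 \<le> SDP A"
proof -
  obtain y where y: "A *v y = 0" "vec_l1_norm y = 1" "S A = norm y"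
    using S_attained[OF assms] .
  then have "trace (outer_square y) \<le> SDP A"
    by (intro trace_le_SDP outer_square_feasible) auto
  with y(3) show ?thesis
    by (simp add: trace_outer_square)
qed

end
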